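(* For any polynomial $p=\sum_\alpha c_\alpha x^\alpha\in\mathbb{R}[x_1,\dots,x_n]$ of degree at most $m$ and any nonempty compact convex set $S\subseteq[0,1]^n$, $$z^*_S-z^{mono}_S\le L'(p)\binom{n+m}{n}.$$
   Context: $z^*_S:=\min\{p(x)\mid x\in S\}$. The sum defining $p$ is finite, over exponents $\alpha\in\mathbb{Z}_{\ge0}^n$ with $|\alpha|:=\sum_j\alpha_j\le m$. Monomial convexification bound: for each monomial $x^\alpha$ appearing in $p$, let $J_\alpha=\{j\mid\alpha_j\ge1\}$, let $x_{J_\alpha}$ be the subvector of the variables appearing in the monomial, and let $$H_\alpha:=\operatorname{conv}\Big\{\big(x_{J_\alpha},\,x^\alpha\big)\;\Big|\; x\in S\Big\}$$ be the convex hull of the graph of the monomial. Then $$z^{mono}_S:=\min\Big\{\sum_\alpha c_\alpha w_\alpha\;\Big|\; x\in S,\ (x_{J_\alpha},w_\alpha)\in H_\alpha\ \text{ for all }\alpha\Big\}.$$ For $d\ge2$ put $\mathscr{C}^1_d:=(1-\frac1d)d^{\frac1{1-d}}$ and $\mathscr{C}^2_d:=(1-\frac1d)^d$, with the convention $\mathscr{C}^1_d=\mathscr{C}^2_d=0$ for $d\in\{0,1\}$. Then $$L'(p):=\max\Big\{\max_{\alpha:\,c_\alpha>0}c_\alpha\,\mathscr{C}^2_{|\alpha|},\ \max_{\alpha:\,c_\alpha<0}-c_\alpha\,\mathscr{C}^1_{|\alpha|}\Big\},$$ where a maximum over an empty index set is taken to be $0$. *)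

theory Defs
  imports "HOL-Analysis.Analysis" "HOL-Library.Poly_Mapping"
begin

text \<open>
  The polynomial ring in the variables indexed by the finite type \<open>'n\<close> (so n is \<open>CARD('n)\<close>):
  an exponent vector assigns a natural number to each variable, and a polynomial is a finitely
  supported family of real coefficients; \<open>Poly_Mapping.keys p\<close> is the set of exponents of
  the monomials appearing in \<open>p\<close>.
\<close>

type_synonym 'n exponent = "'n \<Rightarrow>\<^sub>0 nat"
type_synonym 'n mvpoly = "'n exponent \<Rightarrow>\<^sub>0 real"

definition total_deg :: "('n::finite) exponent \<Rightarrow> nat" where
  "total_deg \<alpha> = (\<Sum>j\<in>UNIV. Poly_Mapping.lookup \<alpha> j)"

definition degree_at_most :: "('n::finite) mvpoly \<Rightarrow> nat \<Rightarrow> bool" where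
  "degree_at_most p m \<longleftrightarrow> (\<forall>\<alpha>\<in>Poly_Mapping.keys p. total_deg \<alpha> \<le> m)"

definition monom_eval :: "('n::finite) exponent \<Rightarrow> real ^ 'n \<Rightarrow> real" where
  "monom_eval \<alpha> x = (\<Prod>j\<in>UNIV. (x $ j) ^ Poly_Mapping.lookup \<alpha> j)"

definition mvpoly_eval :: "('n::finite) mvpoly \<Rightarrow> real ^ 'n \<Rightarrow> real" where
  "mvpoly_eval p x =
     (\<Sum>\<alpha>\<in>Poly_Mapping.keys p. Poly_Mapping.lookup p \<alpha> * monom_eval \<alpha> x)"

text \<open>
  The minimum of a set of reals is rendered as its least element rather than its infimum, so
  that attainment is not built into the definition.
\<close>

definition min_value :: "real set \<Rightarrow> real" where
  "min_value V = (LEAST v. v \<in> V)"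

definition z_opt :: "('n::finite) mvpoly \<Rightarrow> (real ^ 'n) set \<Rightarrow> real" where
  "z_opt p S = min_value {mvpoly_eval p x | x. x \<in> S}"

definition var_support :: "('n::finite) exponent \<Rightarrow> 'n set" where
  "var_support \<alpha> = {j. Poly_Mapping.lookup \<alpha> j \<ge> 1}"

text \<open>
  The subvector of \<open>x\<close> with coordinates in \<open>J\<close> is represented inside the full
  space by zero padding, i.e. the space of vectors indexed by \<open>J\<close> is identified with
  the coordinate subspace of vectors vanishing outside \<open>J\<close>. This identification is
  linear, hence compatible with convex hulls.
\<close>

definition subvector :: "'n set \<Rightarrow> real ^ 'n \<Rightarrow> real ^ ('n::finite)" where
  "subvector J x = (\<chi> j. if j \<in> J then x $ j else 0)"

definition monom_hull ::
    "('n::finite) exponent \<Rightarrow> (real ^ 'n) set \<Rightarrow> ((real ^ 'n) \<times> real) set" where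
  "monom_hull \<alpha> S =
     convex hull {(subvector (var_support \<alpha>) x, monom_eval \<alpha> x) | x. x \<in> S}"

definition z_mono :: "('n::finite) mvpoly \<Rightarrow> (real ^ 'n) set \<Rightarrow> real" where
  "z_mono p S = min_value
     {\<Sum>\<alpha>\<in>Poly_Mapping.keys p. Poly_Mapping.lookup p \<alpha> * w \<alpha> | x w.
        x \<in> S \<and>
        (\<forall>\<alpha>\<in>Poly_Mapping.keys p.
           (subvector (var_support \<alpha>) x, w \<alpha>) \<in> monom_hull \<alpha> S)}"

definition C1 :: "nat \<Rightarrow> real" where
  "C1 d = (if d \<ge> 2 then (1 - 1 / real d) * real d powr (1 / (1 - real d)) else 0)"

definition C2 :: "nat \<Rightarrow> real" where
  "C2 d = (if d \<ge> 2 then (1 - 1 / real d) ^ d else 0)"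

definition max_or_zero :: "real set \<Rightarrow> real" where
  "max_or_zero A = (if A = {} then 0 else Max A)"

definition L' :: "('n::finite) mvpoly \<Rightarrow> real" where
  "L' p = max
     (max_or_zero {Poly_Mapping.lookup p \<alpha> * C2 (total_deg \<alpha>) | \<alpha>.
                     Poly_Mapping.lookup p \<alpha> > 0})
     (max_or_zero {- Poly_Mapping.lookup p \<alpha> * C1 (total_deg \<alpha>) | \<alpha>.
                     Poly_Mapping.lookup p \<alpha> < 0})"

end

theory Submission
  imports Defs
begin

text \<open>
  At a minimizer \<open>(x, w)\<close> of the relaxed problem the gap is at most
  \<open>\<Sum>\<alpha>. c\<^sub>\<alpha> (x\<^sup>\<alpha> - w\<^sub>\<alpha>)\<close>, so it suffices to bound each summand by
  \<open>L'\<close> and to count the exponents of degree at most \<open>m\<close>. Write \<open>d = |\<alpha>|\<close>.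
  On the unit cube \<open>1 - \<Sum>\<^sub>j \<alpha>\<^sub>j (1 - y\<^sub>j) \<le> y\<^sup>\<alpha> \<le> y\<^sub>j\<close> for every \<open>j\<close> in the
  support of \<open>\<alpha>\<close>, and since these bounds are affine they pass to the convex hull of the graph.
  With \<open>t\<close> the least coordinate of \<open>x\<close> in the support this gives
  \<open>w - x\<^sup>\<alpha> \<le> t - t\<^sup>d\<close>, whose maximum is \<open>C1 d\<close>. With \<open>s\<close> the \<open>\<alpha>\<close>-weighted mean
  of the coordinates, the inequality of the means gives
  \<open>x\<^sup>\<alpha> - w \<le> s\<^sup>d - max 0 (1 - d (1 - s))\<close>, whose maximum, at \<open>s = 1 - 1/d\<close>, is \<open>C2 d\<close>.
\<close>

section \<open>One-variable inequalities behind \<open>C1\<close> and \<open>C2\<close>\<close>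

text \<open>Bernoulli's inequality at \<open>t / u\<close>, scaled by \<open>u ^ d\<close>. This
  tangent-line bound replaces derivative tests in the two maximizations below.\<close>

lemma power_ge_tangent:
  fixes t u :: real
  assumes "0 < u" "0 \<le> t"
  shows "u ^ d + real d * u ^ (d - 1) * (t - u) \<le> t ^ d"
proof (cases d)
  case (Suc k)
  have "1 + real d * (t / u - 1) \<le> (1 + (t / u - 1)) ^ d"
    by (rule Bernoulli_inequality) (use assms in simp)
  then have "u ^ d * (1 + real d * (t / u - 1)) \<le> u ^ d * (t / u) ^ d"
    using assms by (intro mult_left_mono) auto
  moreover have "u ^ d * (t / u) ^ d = t ^ d"
    using assms by (simp add: power_divide)
  moreover have "u ^ d * (1 + real d * (t / u - 1)) = u ^ d + real d * u ^ (d - 1) * (t - u)"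
    using assms Suc by (simp add: field_simps)
  ultimately show ?thesis by simp
qed simp

lemma diff_power_le_C1:
  fixes t :: real
  assumes "0 \<le> t" "1 \<le> d"
  shows "t - t ^ d \<le> C1 d"
proof (cases "d = 1")
  case False
  then have d: "2 \<le> d" using assms by simp
  \<comment> \<open>The critical point of \<open>t - t ^ d\<close>, that is, the root of
    \<open>d * u ^ (d - 1) = 1\<close>. The tangent to the power at \<open>u\<close> therefore has
    slope 1.\<close>
  define u where "u = real d powr (1 / (1 - real d))"
  have u: "u > 0" using d by (simp add: u_def)
  have "u ^ (d - 1) = u powr real (d - 1)"
    using u by (simp add: powr_realpow)
  also have "\<dots> = real d powr (1 / (1 - real d) * (real d - 1))"
    using d by (simp add: u_def powr_powr of_nat_diff)
  also have "1 / (1 - real d) * (real d - 1) = -1"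
    using d by (simp add: divide_simps)
  also have "real d powr -1 = 1 / real d"
    using d by (simp add: powr_minus divide_inverse)
  finally have up: "u ^ (d - 1) = 1 / real d" .
  have "u ^ d = u * u ^ (d - 1)"
    using d by (cases d) auto
  then have ud: "u ^ d = u / real d"
    using up by simp
  have "u ^ d + (t - u) \<le> t ^ d"
    using power_ge_tangent[OF u assms(1), of d] d up by simp
  moreover have "C1 d = u - u ^ d"
    using d by (simp add: C1_def ud u_def[symmetric] algebra_simps)
  ultimately show ?thesis by simp
qed (simp add: C1_def)

text \<open>The affine term \<open>1 - d * (1 - s)\<close> changes sign at
  \<open>r = 1 - 1 / d\<close>. Left of \<open>r\<close> the power is monotone. Right of
  \<open>r\<close>, the tangent at \<open>s\<close>, evaluated at \<open>r\<close>, shows that the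
  power exceeds \<open>r ^ d\<close> by at most \<open>d * (s - r)\<close>, which is exactly the
  affine term.\<close>

lemma power_diff_le_C2:
  fixes s :: real
  assumes "0 \<le> s" "s \<le> 1" "1 \<le> d"
  shows "s ^ d - max 0 (1 - real d * (1 - s)) \<le> C2 d"
proof (cases "d = 1")
  case False
  then have d: "2 \<le> d" using assms by simp
  define r where "r = 1 - 1 / real d"
  have r: "0 < r" "real d * r = real d - 1" and C2: "C2 d = r ^ d"
    using d by (simp_all add: r_def C2_def right_diff_distrib)
  show ?thesis
  proof (cases "s \<le> r")
    case True
    then have "s ^ d \<le> r ^ d" using assms by (intro power_mono)
    then show ?thesis by (simp add: C2 max_def)
  next
    case False
    then have s: "0 < s" "0 \<le> s - r" using r by auto
    have "s ^ (d - 1) * (s - r) \<le> 1 * (s - r)"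
      using assms s by (intro mult_right_mono power_le_one) auto
    then have "real d * (s ^ (d - 1) * (s - r)) \<le> real d * (s - r)"
      by (intro mult_left_mono) auto
    moreover have "s ^ d + real d * s ^ (d - 1) * (r - s) \<le> r ^ d"
      using power_ge_tangent[of s r d] s r by simp
    ultimately have "s ^ d - (1 - real d * (1 - s)) \<le> C2 d"
      using r by (simp add: C2 algebra_simps)
    then show ?thesis by simp
  qed
qed (simp add: C2_def)

lemma C1_nonneg: "0 \<le> C1 d"
  by (simp add: C1_def)

lemma C2_nonneg: "0 \<le> C2 d"
  by (simp add: C2_def)

section \<open>Bounds on a monomial over the unit cube\<close>

lemma monom_eval_nonneg:
  assumes "\<And>j. 0 \<le> x $ j"
  shows "0 \<le> monom_eval \<alpha> x"
  using assms by (simp add: monom_eval_def prod_nonneg)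

lemma monom_eval_le_1:
  assumes "\<And>j. 0 \<le> x $ j \<and> x $ j \<le> 1"
  shows "monom_eval \<alpha> x \<le> 1"
  unfolding monom_eval_def using assms by (intro prod_le_1) (auto intro: power_le_one)

lemma monom_eval_le_coordinate:
  assumes "\<And>j. 0 \<le> x $ j \<and> x $ j \<le> 1" "j \<in> var_support \<alpha>"
  shows "monom_eval \<alpha> x \<le> x $ j"
proof -
  have "monom_eval \<alpha> x =
      (x $ j) ^ Poly_Mapping.lookup \<alpha> j * (\<Prod>i\<in>UNIV - {j}. (x $ i) ^ Poly_Mapping.lookup \<alpha> i)"
    unfolding monom_eval_def by (rule prod.remove) auto
  also have "\<dots> \<le> (x $ j) ^ Poly_Mapping.lookup \<alpha> j * 1"
    using assms(1) by (intro mult_left_mono prod_le_1) (auto intro: power_le_one)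
  also have "\<dots> \<le> x $ j"
    using assms power_decreasing[of 1 "Poly_Mapping.lookup \<alpha> j" "x $ j"]
    by (simp add: var_support_def)
  finally show ?thesis .
qed

text \<open>The left side is the first-order expansion at the all-ones point. Weierstrass' product
  inequality reduces the product to its factors, and Bernoulli bounds each factor.\<close>

lemma monom_eval_ge_tangent:
  assumes "\<And>j. 0 \<le> x $ j \<and> x $ j \<le> 1"
  shows "1 - (\<Sum>j\<in>UNIV. real (Poly_Mapping.lookup \<alpha> j) * (1 - x $ j)) \<le> monom_eval \<alpha> x"
proof -
  have "1 - (x $ j) ^ Poly_Mapping.lookup \<alpha> j \<le> real (Poly_Mapping.lookup \<alpha> j) * (1 - x $ j)" for j
    using Bernoulli_inequality[of "x $ j - 1" "Poly_Mapping.lookup \<alpha> j"] assms[of j]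
    by (simp add: algebra_simps)
  then have "(\<Sum>j\<in>UNIV. 1 - (x $ j) ^ Poly_Mapping.lookup \<alpha> j)
      \<le> (\<Sum>j\<in>UNIV. real (Poly_Mapping.lookup \<alpha> j) * (1 - x $ j))"
    by (rule sum_mono)
  moreover have "1 - (\<Sum>j\<in>UNIV. 1 - (x $ j) ^ Poly_Mapping.lookup \<alpha> j)
      \<le> (\<Prod>j\<in>UNIV. 1 - (1 - (x $ j) ^ Poly_Mapping.lookup \<alpha> j))"
    by (rule Weierstrass_prod_ineq) (use assms in \<open>auto intro: power_le_one\<close>)
  ultimately show ?thesis by (simp add: monom_eval_def)
qed

lemma total_deg_pos_iff: "1 \<le> total_deg \<alpha> \<longleftrightarrow> var_support \<alpha> \<noteq> {}"
  by (auto simp: total_deg_def var_support_def Suc_le_eq sum_pos2 intro: ccontr)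

text \<open>Weighted AM-GM. After division by the mean \<open>s\<close>, each coordinate satisfies
  \<open>u \<le> exp (u - 1)\<close>; in the product of the powers the exponents sum to 0.\<close>

lemma monom_eval_le_mean_power:
  fixes x :: "real ^ 'n::finite"
  assumes "\<And>j. 0 \<le> x $ j" "1 \<le> total_deg \<alpha>"
  shows "monom_eval \<alpha> x
    \<le> ((\<Sum>j\<in>UNIV. real (Poly_Mapping.lookup \<alpha> j) * x $ j) / real (total_deg \<alpha>)) ^ total_deg \<alpha>"
    (is "_ \<le> ?s ^ _")
proof (cases "?s = 0")
  \<comment> \<open>Division by the mean is impossible here, but a zero mean forces some coordinate
    in the support to vanish, and with it the monomial.\<close>
  case True
  obtain j where j: "j \<in> var_support \<alpha>"
    using assms total_deg_pos_iff by blast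
  have "(\<Sum>j\<in>UNIV. real (Poly_Mapping.lookup \<alpha> j) * x $ j) = 0"
    using True assms by auto
  then have "real (Poly_Mapping.lookup \<alpha> j) * x $ j = 0"
    using assms by (subst (asm) sum_nonneg_eq_0_iff) auto
  then have "(x $ j) ^ Poly_Mapping.lookup \<alpha> j = 0"
    using j by (auto simp: var_support_def)
  then have "monom_eval \<alpha> x = 0"
    unfolding monom_eval_def by (intro prod_zero) auto
  then show ?thesis
    using assms(1) by (auto intro!: zero_le_power divide_nonneg_nonneg sum_nonneg)
next
  case False
  let ?a = "Poly_Mapping.lookup \<alpha>"
  define s where "s = ?s"
  have "s \<ge> 0" using assms by (auto simp: s_def intro!: divide_nonneg_nonneg sum_nonneg)
  then have s: "s > 0" using False s_def by linarith
  have q: "0 \<le> x $ j / s" for j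
    using assms(1) s by simp
  have step: "(x $ j / s) ^ ?a j \<le> exp (real (?a j) * (x $ j / s - 1))" for j
  proof -
    have "x $ j / s \<le> exp (x $ j / s - 1)"
      using exp_ge_add_one_self[of "x $ j / s - 1"] by linarith
    then have "(x $ j / s) ^ ?a j \<le> exp (x $ j / s - 1) ^ ?a j"
      using q by (rule power_mono)
    then show ?thesis by (simp add: exp_of_nat_mult)
  qed
  have "(\<Prod>j\<in>UNIV. (x $ j / s) ^ ?a j) \<le> (\<Prod>j\<in>UNIV. exp (real (?a j) * (x $ j / s - 1)))"
    using q step by (simp add: prod_mono zero_le_power del: power_divide)
  also have "\<dots> = exp (\<Sum>j\<in>UNIV. real (?a j) * (x $ j / s - 1))"
    by (simp add: exp_sum)
  also have "(\<Sum>j\<in>UNIV. real (?a j) * (x $ j / s - 1))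
      = (\<Sum>j\<in>UNIV. real (?a j) * x $ j) / s - real (total_deg \<alpha>)"
    by (simp add: right_diff_distrib sum_subtractf sum_divide_distrib total_deg_def)
  also have "(\<Sum>j\<in>UNIV. real (?a j) * x $ j) = s * real (total_deg \<alpha>)"
    using assms(2) by (simp add: s_def)
  finally have "(\<Prod>j\<in>UNIV. (x $ j / s) ^ ?a j) \<le> 1"
    using s by simp
  moreover have "(\<Prod>j\<in>UNIV. (x $ j / s) ^ ?a j) = monom_eval \<alpha> x / s ^ total_deg \<alpha>"
    unfolding monom_eval_def total_deg_def
    by (simp only: power_divide prod_dividef power_sum)
  ultimately have "monom_eval \<alpha> x \<le> s ^ total_deg \<alpha>"
    using s by (simp add: pos_divide_le_eq)
  then show ?thesis by (simp only: s_def)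
qed

section \<open>Continuity, and transfer of affine bounds to the hull\<close>

lemma continuous_on_monom_eval [continuous_intros]: "continuous_on A (monom_eval \<alpha>)"
  unfolding monom_eval_def by (intro continuous_intros)

lemma continuous_on_mvpoly_eval [continuous_intros]: "continuous_on A (mvpoly_eval p)"
  unfolding mvpoly_eval_def by (intro continuous_intros)

lemma continuous_on_subvector [continuous_intros]: "continuous_on A (subvector J)"
  unfolding subvector_def
proof (intro continuous_on_vec_lambda)
  fix i show "continuous_on A (\<lambda>x. if i \<in> J then x $ i else 0)"
    by (cases "i \<in> J") (auto intro!: continuous_intros)
qed

lemma compact_monom_hull:
  assumes "compact S"
  shows "compact (monom_hull \<alpha> S)"
proof -
  have "{(subvector (var_support \<alpha>) x, monom_eval \<alpha> x) | x. x \<in> S}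
      = (\<lambda>x. (subvector (var_support \<alpha>) x, monom_eval \<alpha> x)) ` S"
    by auto
  then show ?thesis
    unfolding monom_hull_def using assms
    by (auto intro!: compact_convex_hull compact_continuous_image continuous_intros)
qed

text \<open>The half-space where \<open>f\<close> is at most \<open>b\<close> is convex and contains
  the graph, hence also its hull.\<close>

lemma monom_hull_linear_le:
  assumes "linear f" "q \<in> monom_hull \<alpha> S"
    and "\<And>x. x \<in> S \<Longrightarrow> f (subvector (var_support \<alpha>) x, monom_eval \<alpha> x) \<le> (b :: real)"
  shows "f q \<le> b"
proof -
  have "monom_hull \<alpha> S \<subseteq> f -` {..b}"
    unfolding monom_hull_def
    by (rule hull_minimal) (use assms in \<open>auto intro: convex_linear_vimage\<close>)
  then show ?thesis using assms(2) by auto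
qed

text \<open>The coordinates erased by \<open>subvector\<close> carry weight 0.\<close>

lemma sum_lookup_subvector:
  "(\<Sum>j\<in>UNIV. real (Poly_Mapping.lookup \<alpha> j) * subvector (var_support \<alpha>) x $ j)
    = (\<Sum>j\<in>UNIV. real (Poly_Mapping.lookup \<alpha> j) * x $ j)"
  by (rule sum.cong) (auto simp: subvector_def var_support_def Suc_le_eq)

lemma monom_hull_bounds:
  fixes S :: "(real ^ 'n::finite) set"
  assumes S: "\<And>y j. y \<in> S \<Longrightarrow> 0 \<le> y $ j \<and> y $ j \<le> 1"
    and "(subvector (var_support \<alpha>) x, w) \<in> monom_hull \<alpha> S"
  shows monom_hull_nonneg: "0 \<le> w"
    and monom_hull_le_1: "w \<le> 1"
    and monom_hull_le_coordinate: "\<And>j. j \<in> var_support \<alpha> \<Longrightarrow> w \<le> x $ j"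
    and monom_hull_ge_tangent:
      "1 - (\<Sum>j\<in>UNIV. real (Poly_Mapping.lookup \<alpha> j) * (1 - x $ j)) \<le> w"
proof -
  let ?a = "\<lambda>j. real (Poly_Mapping.lookup \<alpha> j)"
  note H = monom_hull_linear_le[OF _ assms(2)]
  have "linear (\<lambda>q::(real^'n) \<times> real. - snd q)"
    by (intro linearI) auto
  from H[OF this, of 0] show "0 \<le> w"
    using S by (auto intro: monom_eval_nonneg)
  have "linear (\<lambda>q::(real^'n) \<times> real. snd q)"
    by (intro linearI) auto
  from H[OF this, of 1] show "w \<le> 1"
    using S by (auto intro: monom_eval_le_1)
  show "w \<le> x $ j" if j: "j \<in> var_support \<alpha>" for j
  proof -
    have "linear (\<lambda>q::(real^'n) \<times> real. snd q - fst q $ j)"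
      by (intro linearI) (auto simp: algebra_simps)
    from H[OF this, of 0] show ?thesis
      using S j by (auto simp: subvector_def intro: monom_eval_le_coordinate)
  qed
  \<comment> \<open>The constant is split off so that a linear functional with bound
    \<open>total_deg \<alpha> - 1\<close> expresses the tangent inequality.\<close>
  have tangent: "1 - (\<Sum>j\<in>UNIV. ?a j * (1 - y $ j))
      = 1 - real (total_deg \<alpha>) + (\<Sum>j\<in>UNIV. ?a j * y $ j)" for y :: "real ^ 'n"
    by (simp add: right_diff_distrib sum_subtractf total_deg_def)
  have "linear (\<lambda>q::(real^'n) \<times> real. (\<Sum>j\<in>UNIV. ?a j * fst q $ j) - snd q)"
    by (intro linearI) (auto simp: algebra_simps sum.distrib sum_distrib_left)
  moreover have "(\<Sum>j\<in>UNIV. ?a j * y $ j) - monom_eval \<alpha> y \<le> real (total_deg \<alpha>) - 1"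
    if "y \<in> S" for y
    using monom_eval_ge_tangent[of y \<alpha>] S that by (simp add: tangent)
  ultimately show "1 - (\<Sum>j\<in>UNIV. ?a j * (1 - x $ j)) \<le> w"
    using H[of "\<lambda>q. (\<Sum>j\<in>UNIV. ?a j * fst q $ j) - snd q" "real (total_deg \<alpha>) - 1"]
    by (simp add: tangent sum_lookup_subvector)
qed

section \<open>Error of a single monomial in both directions\<close>

lemma monom_hull_minus_monom_le:
  fixes S :: "(real ^ 'n::finite) set"
  assumes S: "\<And>y j. y \<in> S \<Longrightarrow> 0 \<le> y $ j \<and> y $ j \<le> 1" and "x \<in> S"
    and w: "(subvector (var_support \<alpha>) x, w) \<in> monom_hull \<alpha> S"
  shows "w - monom_eval \<alpha> x \<le> C1 (total_deg \<alpha>)"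
proof (cases "var_support \<alpha> = {}")
  \<comment> \<open>The constant monomial has no coordinate to minimize over, and the bound
    \<open>w \<le> 1\<close> already suffices.\<close>
  case True
  then have "Poly_Mapping.lookup \<alpha> j = 0" for j
    by (auto simp: var_support_def Suc_le_eq)
  then have "monom_eval \<alpha> x = 1" by (simp add: monom_eval_def)
  then show ?thesis
    using monom_hull_le_1[OF S w] C1_nonneg[of "total_deg \<alpha>"] by simp
next
  case False
  define t where "t = Min (($) x ` var_support \<alpha>)"
  have "t \<in> ($) x ` var_support \<alpha>"
    unfolding t_def using False by (intro Min_in) auto
  then obtain i where i: "i \<in> var_support \<alpha>" "t = x $ i" by auto
  have t: "t \<le> x $ j" if "j \<in> var_support \<alpha>" for j
    unfolding t_def using that by (intro Min_le) auto
  have t0: "0 \<le> t" using S[OF \<open>x \<in> S\<close>] i by auto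
  \<comment> \<open>Lowering every supported coordinate to \<open>t\<close> can only decrease the
    monomial; the other factors are 1.\<close>
  have "t ^ total_deg \<alpha> = (\<Prod>j\<in>UNIV. t ^ Poly_Mapping.lookup \<alpha> j)"
    by (simp add: total_deg_def power_sum)
  also have "\<dots> \<le> monom_eval \<alpha> x"
    unfolding monom_eval_def
  proof (rule prod_mono)
    fix j
    show "0 \<le> t ^ Poly_Mapping.lookup \<alpha> j \<and>
        t ^ Poly_Mapping.lookup \<alpha> j \<le> x $ j ^ Poly_Mapping.lookup \<alpha> j"
    proof (cases "j \<in> var_support \<alpha>")
      case True
      then show ?thesis using t[of j] t0 by (auto intro!: power_mono)
    qed (auto simp: var_support_def Suc_le_eq)
  qed
  finally have "t ^ total_deg \<alpha> \<le> monom_eval \<alpha> x" .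
  moreover have "w \<le> t"
    using monom_hull_le_coordinate[OF S w] i by auto
  moreover have "t - t ^ total_deg \<alpha> \<le> C1 (total_deg \<alpha>)"
    using t0 False total_deg_pos_iff by (intro diff_power_le_C1) auto
  ultimately show ?thesis by simp
qed

lemma monom_minus_monom_hull_le:
  fixes S :: "(real ^ 'n::finite) set"
  assumes S: "\<And>y j. y \<in> S \<Longrightarrow> 0 \<le> y $ j \<and> y $ j \<le> 1" and "x \<in> S"
    and w: "(subvector (var_support \<alpha>) x, w) \<in> monom_hull \<alpha> S"
  shows "monom_eval \<alpha> x - w \<le> C2 (total_deg \<alpha>)"
proof (cases "1 \<le> total_deg \<alpha>")
  case False
  then have "Poly_Mapping.lookup \<alpha> j = 0" for j
    using total_deg_pos_iff[of \<alpha>] by (auto simp: var_support_def Suc_le_eq)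
  \<comment> \<open>For the constant monomial the tangent bound reads
    \<open>1 \<le> w\<close>.\<close>
  then show ?thesis
    using monom_hull_ge_tangent[OF S w] C2_nonneg[of "total_deg \<alpha>"] by (simp add: monom_eval_def)
next
  case True
  let ?a = "\<lambda>j. real (Poly_Mapping.lookup \<alpha> j)"
  define s where "s = (\<Sum>j\<in>UNIV. ?a j * x $ j) / real (total_deg \<alpha>)"
  have x: "0 \<le> x $ j" "x $ j \<le> 1" for j using S[OF \<open>x \<in> S\<close>] by auto
  have ds: "real (total_deg \<alpha>) * s = (\<Sum>j\<in>UNIV. ?a j * x $ j)"
    using True by (simp add: s_def)
  have "(\<Sum>j\<in>UNIV. ?a j * x $ j) \<le> (\<Sum>j\<in>UNIV. ?a j * 1)"
    using x by (intro sum_mono mult_left_mono) auto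
  also have "\<dots> = real (total_deg \<alpha>)"
    by (simp add: total_deg_def)
  finally have "s \<le> 1"
    using True by (simp add: s_def)
  moreover have "0 \<le> s"
    using x by (auto simp: s_def intro!: divide_nonneg_nonneg sum_nonneg)
  ultimately have
    "s ^ total_deg \<alpha> - max 0 (1 - real (total_deg \<alpha>) * (1 - s)) \<le> C2 (total_deg \<alpha>)"
    using True by (intro power_diff_le_C2)
  moreover have "monom_eval \<alpha> x \<le> s ^ total_deg \<alpha>"
    unfolding s_def using x True by (intro monom_eval_le_mean_power)
  \<comment> \<open>The tangent bound depends on \<open>x\<close> only through the weighted mean
    \<open>s\<close>, so the estimate becomes one-dimensional.\<close>
  moreover have "1 - (\<Sum>j\<in>UNIV. ?a j * (1 - x $ j)) = 1 - real (total_deg \<alpha>) * (1 - s)"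
    using ds by (simp add: right_diff_distrib sum_subtractf total_deg_def)
  then have "max 0 (1 - real (total_deg \<alpha>) * (1 - s)) \<le> w"
    using monom_hull_nonneg[OF S w] monom_hull_ge_tangent[OF S w] by simp
  ultimately show ?thesis by linarith
qed

section \<open>\<open>L'\<close> dominates every weighted coefficient\<close>

lemma le_max_or_zero: "finite A \<Longrightarrow> a \<in> A \<Longrightarrow> a \<le> max_or_zero A"
  by (auto simp: max_or_zero_def)

lemma max_or_zero_nonneg:
  assumes "finite A" "\<And>a. a \<in> A \<Longrightarrow> 0 \<le> a"
  shows "0 \<le> max_or_zero A"
  using assms Max_in[of A] by (auto simp: max_or_zero_def)

text \<open>A coefficient of either strict sign is nonzero, so both index sets lie in the finite set
  \<open>keys p\<close> and \<open>Max\<close> is a true maximum.\<close>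

lemma
  fixes p :: "'n::finite mvpoly"
  shows L'_nonneg: "0 \<le> L' p"
    and coeff_C2_le_L': "0 < Poly_Mapping.lookup p \<alpha> \<Longrightarrow>
      Poly_Mapping.lookup p \<alpha> * C2 (total_deg \<alpha>) \<le> L' p"
    and coeff_C1_le_L': "Poly_Mapping.lookup p \<alpha> < 0 \<Longrightarrow>
      - Poly_Mapping.lookup p \<alpha> * C1 (total_deg \<alpha>) \<le> L' p"
proof -
  let ?P = "{Poly_Mapping.lookup p \<alpha> * C2 (total_deg \<alpha>) | \<alpha>. Poly_Mapping.lookup p \<alpha> > 0}"
  let ?N = "{- Poly_Mapping.lookup p \<alpha> * C1 (total_deg \<alpha>) | \<alpha>. Poly_Mapping.lookup p \<alpha> < 0}"
  have "?P \<subseteq> (\<lambda>\<alpha>. Poly_Mapping.lookup p \<alpha> * C2 (total_deg \<alpha>)) ` Poly_Mapping.keys p"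
    by (auto simp: in_keys_iff)
  then have P: "finite ?P" by (rule finite_subset) simp
  have "?N \<subseteq> (\<lambda>\<alpha>. - Poly_Mapping.lookup p \<alpha> * C1 (total_deg \<alpha>)) ` Poly_Mapping.keys p"
    by (auto simp: in_keys_iff)
  then have N: "finite ?N" by (rule finite_subset) simp
  have "0 \<le> max_or_zero ?P"
    by (rule max_or_zero_nonneg[OF P]) (auto simp: C2_nonneg)
  then show "0 \<le> L' p" by (simp add: L'_def)
  show "Poly_Mapping.lookup p \<alpha> * C2 (total_deg \<alpha>) \<le> L' p"
    if "0 < Poly_Mapping.lookup p \<alpha>"
    unfolding L'_def by (intro max.coboundedI1 le_max_or_zero[OF P]) (use that in auto)
  show "- Poly_Mapping.lookup p \<alpha> * C1 (total_deg \<alpha>) \<le> L' p"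
    if "Poly_Mapping.lookup p \<alpha> < 0"
    unfolding L'_def by (intro max.coboundedI2 le_max_or_zero[OF N]) (use that in auto)
qed

section \<open>Counting exponents of bounded degree\<close>

text \<open>Appending the slack \<open>m - |\<alpha>|\<close> turns an exponent into a composition of \<open>m\<close> into \<open>n + 1\<close> parts.\<close>

lemma card_total_deg_le:
  "card {\<alpha> :: 'n::finite exponent. total_deg \<alpha> \<le> m} \<le> (CARD('n) + m) choose CARD('n)"
proof -
  obtain us :: "'n list" where us: "set us = UNIV" "distinct us"
    using finite_distinct_list[OF finite[of "UNIV :: 'n set"]] by auto
  then have len: "length us = CARD('n)"
    using distinct_card by metis
  let ?L = "{l :: nat list. length l = Suc (CARD('n)) \<and> sum_list l = m}"
  let ?f = "\<lambda>\<alpha> :: 'n exponent. (m - total_deg \<alpha>) # map (Poly_Mapping.lookup \<alpha>) us"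
  have "inj ?f"
  proof
    fix \<alpha> \<beta> :: "'n exponent"
    assume "?f \<alpha> = ?f \<beta>"
    then have "map (Poly_Mapping.lookup \<alpha>) us = map (Poly_Mapping.lookup \<beta>) us" by simp
    then show "\<alpha> = \<beta>"
      using us by (intro poly_mapping_eqI) (simp add: map_eq_conv)
  qed
  then have "inj_on ?f {\<alpha>. total_deg \<alpha> \<le> m}"
    by (rule inj_on_subset) simp
  moreover have "sum_list (map (Poly_Mapping.lookup \<alpha>) us) = total_deg \<alpha>" for \<alpha>
    using us by (simp add: total_deg_def sum_list_distinct_conv_sum_set)
  then have "?f ` {\<alpha>. total_deg \<alpha> \<le> m} \<subseteq> ?L"
    using len by auto
  moreover have "finite ?L"
  proof (rule finite_subset)
    show "?L \<subseteq> {l. set l \<subseteq> {..m} \<and> length l = Suc (CARD('n))}"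
      by (auto dest: member_le_sum_list)
    show "finite {l. set l \<subseteq> {..m} \<and> length l = Suc (CARD('n))}"
      by (rule finite_lists_length_eq) simp
  qed
  ultimately have "card {\<alpha> :: 'n exponent. total_deg \<alpha> \<le> m} \<le> card ?L"
    by (rule card_inj_on_le)
  \<comment> \<open>Stars and bars for \<open>CARD('n) + 1\<close> parts summing to
    \<open>m\<close>.\<close>
  also have "\<dots> = (m + CARD('n)) choose m"
    by (simp add: card_length_sum_list)
  also have "\<dots> = (CARD('n) + m) choose CARD('n)"
    using binomial_symmetric[of m "m + CARD('n)"] by (simp add: add.commute)
  finally show ?thesis .
qed

text \<open>Each entry is at most the total degree, so the exponents embed in a finite box.
  Finiteness is needed for monotonicity of \<open>card\<close>, which is 0 on infinite sets.\<close>

lemma finite_total_deg_le: "finite {\<alpha> :: 'n::finite exponent. total_deg \<alpha> \<le> m}"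
proof -
  have "inj (Poly_Mapping.lookup :: 'n exponent \<Rightarrow> _)"
    by (rule injI) (rule poly_mapping_eqI, simp)
  moreover have "Poly_Mapping.lookup ` {\<alpha> :: 'n exponent. total_deg \<alpha> \<le> m}
      \<subseteq> Pi\<^sub>E UNIV (\<lambda>_. {..m})"
  proof (clarsimp simp: PiE_def extensional_def)
    fix \<alpha> :: "'n exponent" and j
    assume "total_deg \<alpha> \<le> m"
    moreover have "Poly_Mapping.lookup \<alpha> j \<le> total_deg \<alpha>"
      unfolding total_deg_def by (rule member_le_sum) auto
    ultimately show "Poly_Mapping.lookup \<alpha> j \<le> m" by simp
  qed
  then have "finite (Poly_Mapping.lookup ` {\<alpha> :: 'n exponent. total_deg \<alpha> \<le> m})"
    by (rule finite_subset) (auto intro: finite_PiE)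
  ultimately show ?thesis
    using finite_imageD inj_on_subset[OF _ subset_UNIV] by metis
qed

section \<open>Attainment of both minima\<close>

text \<open>\<open>LEAST\<close> describes a minimum only where one exists; compactness supplies
  it.\<close>

lemma min_value_in_and_le:
  assumes "compact V" "V \<noteq> {}"
  shows "min_value V \<in> V" "\<And>v. v \<in> V \<Longrightarrow> min_value V \<le> v"
proof -
  obtain u where u: "u \<in> V" "\<And>v. v \<in> V \<Longrightarrow> u \<le> v"
    using compact_attains_inf[OF assms] by auto
  then have "min_value V = u"
    unfolding min_value_def by (intro Least_equality)
  with u show "min_value V \<in> V" "\<And>v. v \<in> V \<Longrightarrow> min_value V \<le> v" by auto
qed

text \<open>Induction over the monomials, adding one hull variable at a time. The point
  \<open>x\<close> is kept beside the partial objective because the next hull constraint refers to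
  the same \<open>x\<close>.\<close>

lemma compact_relaxation_graph:
  fixes S :: "(real ^ 'n::finite) set"
  assumes "compact S" "finite A"
  shows "compact {(x, \<Sum>\<alpha>\<in>A. c \<alpha> * w \<alpha>) | x w. x \<in> S \<and>
    (\<forall>\<alpha>\<in>A. (subvector (var_support \<alpha>) x, w \<alpha>) \<in> monom_hull \<alpha> S)}"
    (is "compact (?K A)")
  using assms(2)
proof (induction A rule: finite_induct)
  case empty
  have "?K {} = S \<times> {0}" by auto
  then show ?case using assms(1) by (simp add: compact_Times)
next
  case (insert a A)
  \<comment> \<open>The new value \<open>u\<close> ranges over the compact projection of its hull;
    the constraint linking it to \<open>x\<close> is a closed condition.\<close>
  let ?G = "(?K A \<times> snd ` monom_hull a S) \<inter>
    (\<lambda>(q, u). (subvector (var_support a) (fst q), u)) -` monom_hull a S"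
  have hull: "compact (monom_hull a S)" by (rule compact_monom_hull[OF assms(1)])
  have "compact (snd ` monom_hull a S)"
    using hull by (intro compact_continuous_image continuous_intros)
  moreover have "continuous_on UNIV
      (\<lambda>(q::(real^'n) \<times> real, u::real). (subvector (var_support a) (fst q), u))"
    unfolding split_beta
    by (intro continuous_intros continuous_on_compose2[OF continuous_on_subvector]) auto
  then have "closed ((\<lambda>(q::(real^'n) \<times> real, u::real).
      (subvector (var_support a) (fst q), u)) -` monom_hull a S)"
    using hull by (intro closed_vimage compact_imp_closed)
  ultimately have G: "compact ?G"
    using insert.IH by (intro compact_Int_closed compact_Times)
  have "?K (insert a A) = (\<lambda>(q, u). (fst q, snd q + c a * u)) ` ?G" (is "_ = ?R")
  proof
    show "?K (insert a A) \<subseteq> ?R"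
    proof clarify
      fix x w
      assume x: "x \<in> S"
        "\<forall>\<alpha>\<in>insert a A. (subvector (var_support \<alpha>) x, w \<alpha>) \<in> monom_hull \<alpha> S"
      then have "((x, \<Sum>\<alpha>\<in>A. c \<alpha> * w \<alpha>), w a) \<in> ?G"
        by (auto intro: rev_image_eqI)
      then show "(x, \<Sum>\<alpha>\<in>insert a A. c \<alpha> * w \<alpha>) \<in> ?R"
        by (rule rev_image_eqI) (use insert.hyps in simp)
    qed
    show "?R \<subseteq> ?K (insert a A)"
    proof clarsimp
      fix x w u
      assume x: "x \<in> S" and u: "(subvector (var_support a) x, u) \<in> monom_hull a S"
        and w: "\<forall>\<alpha>\<in>A. (subvector (var_support \<alpha>) x, w \<alpha>) \<in> monom_hull \<alpha> S"
      \<comment> \<open>Since \<open>a\<close> is not in \<open>A\<close>, redefining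
        \<open>w\<close> at \<open>a\<close> leaves the old sum and the old constraints
        unchanged.\<close>
      have "(\<Sum>\<alpha>\<in>insert a A. c \<alpha> * (w(a := u)) \<alpha>) = c a * u + (\<Sum>\<alpha>\<in>A. c \<alpha> * (w(a := u)) \<alpha>)"
        using insert.hyps by simp
      also have "(\<Sum>\<alpha>\<in>A. c \<alpha> * (w(a := u)) \<alpha>) = (\<Sum>\<alpha>\<in>A. c \<alpha> * w \<alpha>)"
        using insert.hyps by (intro sum.cong) auto
      finally show "\<exists>w'. (\<Sum>\<alpha>\<in>A. c \<alpha> * w \<alpha>) + c a * u = (\<Sum>\<alpha>\<in>insert a A. c \<alpha> * w' \<alpha>) \<and>
          (subvector (var_support a) x, w' a) \<in> monom_hull a S \<and>
          (\<forall>\<alpha>\<in>A. (subvector (var_support \<alpha>) x, w' \<alpha>) \<in> monom_hull \<alpha> S)"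
        using u w insert.hyps by (intro exI[of _ "w(a := u)"]) auto
    qed
  qed
  moreover have "continuous_on B (\<lambda>(q::(real^'n) \<times> real, u). (fst q, snd q + c a * u))" for B
    unfolding split_beta by (intro continuous_intros)
  then have "compact ?R"
    using G by (rule compact_continuous_image)
  ultimately show ?case by simp
qed

lemma z_opt_le:
  assumes "compact S" "x \<in> S"
  shows "z_opt p S \<le> mvpoly_eval p x"
proof -
  have "{mvpoly_eval p x | x. x \<in> S} = mvpoly_eval p ` S" by auto
  moreover have "compact (mvpoly_eval p ` S)"
    using assms(1) by (intro compact_continuous_image continuous_intros)
  ultimately show ?thesis
    unfolding z_opt_def using assms(2) by (intro min_value_in_and_le(2)) auto
qed

lemma z_mono_attained:
  fixes S :: "(real ^ 'n::finite) set"
  assumes "compact S" "S \<noteq> {}"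
  obtains x w where "x \<in> S"
    "\<And>\<alpha>. \<alpha> \<in> Poly_Mapping.keys p \<Longrightarrow>
      (subvector (var_support \<alpha>) x, w \<alpha>) \<in> monom_hull \<alpha> S"
    "z_mono p S = (\<Sum>\<alpha>\<in>Poly_Mapping.keys p. Poly_Mapping.lookup p \<alpha> * w \<alpha>)"
proof -
  define V where "V = {\<Sum>\<alpha>\<in>Poly_Mapping.keys p. Poly_Mapping.lookup p \<alpha> * w \<alpha> | x w.
        x \<in> S \<and> (\<forall>\<alpha>\<in>Poly_Mapping.keys p.
           (subvector (var_support \<alpha>) x, w \<alpha>) \<in> monom_hull \<alpha> S)}"
  let ?K = "{(x, \<Sum>\<alpha>\<in>Poly_Mapping.keys p. Poly_Mapping.lookup p \<alpha> * w \<alpha>) | x w. x \<in> S \<and>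
    (\<forall>\<alpha>\<in>Poly_Mapping.keys p. (subvector (var_support \<alpha>) x, w \<alpha>) \<in> monom_hull \<alpha> S)}"
  have "V = snd ` ?K"
    unfolding V_def by force
  moreover have "compact ?K"
    using assms(1) finite_keys by (rule compact_relaxation_graph)
  then have "compact (snd ` ?K)"
    by (intro compact_continuous_image continuous_on_snd continuous_on_id)
  ultimately have "compact V" by simp
  moreover obtain x where "x \<in> S" using assms(2) by auto
  \<comment> \<open>Every point of \<open>S\<close> is feasible for the relaxation when each
    \<open>w \<alpha>\<close> is the monomial's true value.\<close>
  then have "(\<Sum>\<alpha>\<in>Poly_Mapping.keys p. Poly_Mapping.lookup p \<alpha> * monom_eval \<alpha> x) \<in> V"
    unfolding V_def monom_hull_def
    by (intro CollectI exI[of _ x] exI[of _ "\<lambda>\<alpha>. monom_eval \<alpha> x"]) (auto intro!: hull_inc)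
  then have "V \<noteq> {}" by auto
  ultimately have "z_mono p S \<in> V"
    unfolding z_mono_def V_def[symmetric] by (rule min_value_in_and_le(1))
  then show ?thesis unfolding V_def using that by blast
qed

theorem corollary1p2:
  fixes p :: "('n::finite) mvpoly" and m :: nat and S :: "(real ^ 'n) set"
  assumes "degree_at_most p m"
    and "S \<noteq> {}" and "compact S" and "convex S"
    and "S \<subseteq> {x. \<forall>j. 0 \<le> x $ j \<and> x $ j \<le> 1}"
  shows "z_opt p S - z_mono p S \<le> L' p * real ((CARD('n) + m) choose CARD('n))"
proof -
  let ?c = "Poly_Mapping.lookup p" and ?M = "Poly_Mapping.keys p"
  have S: "\<And>y j. y \<in> S \<Longrightarrow> 0 \<le> y $ j \<and> y $ j \<le> 1"
    using assms(5) by auto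
  obtain x w where x: "x \<in> S"
    and w: "\<And>\<alpha>. \<alpha> \<in> ?M \<Longrightarrow> (subvector (var_support \<alpha>) x, w \<alpha>) \<in> monom_hull \<alpha> S"
    and z: "z_mono p S = (\<Sum>\<alpha>\<in>?M. ?c \<alpha> * w \<alpha>)"
    using z_mono_attained[OF assms(3,2)] by blast
  have term_le: "?c \<alpha> * (monom_eval \<alpha> x - w \<alpha>) \<le> L' p" if \<alpha>: "\<alpha> \<in> ?M" for \<alpha>
  proof (cases "?c \<alpha> > 0")
    case True
    then have "?c \<alpha> * (monom_eval \<alpha> x - w \<alpha>) \<le> ?c \<alpha> * C2 (total_deg \<alpha>)"
      using monom_minus_monom_hull_le[OF S x w[OF \<alpha>]] by (intro mult_left_mono) auto
    with coeff_C2_le_L'[OF True] show ?thesis by simp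
  next
    case False
    \<comment> \<open>Exponents in \<open>keys p\<close> have nonzero coefficients, so only the
      negative sign remains.\<close>
    with \<alpha> have c: "?c \<alpha> < 0" by (simp add: in_keys_iff)
    then have "- ?c \<alpha> * (w \<alpha> - monom_eval \<alpha> x) \<le> - ?c \<alpha> * C1 (total_deg \<alpha>)"
      using monom_hull_minus_monom_le[OF S x w[OF \<alpha>]] by (intro mult_left_mono) auto
    with coeff_C1_le_L'[OF c] show ?thesis by (simp add: algebra_simps)
  qed
  have "card ?M \<le> card {\<alpha> :: 'n exponent. total_deg \<alpha> \<le> m}"
    using assms(1) by (intro card_mono finite_total_deg_le) (auto simp: degree_at_most_def)
  then have card: "card ?M \<le> (CARD('n) + m) choose CARD('n)"
    using card_total_deg_le order_trans by blast
  \<comment> \<open>The relaxed minimizer \<open>x\<close> lies in \<open>S\<close>, so its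
    polynomial value bounds the true minimum from above.\<close>
  have "z_opt p S - z_mono p S \<le> mvpoly_eval p x - z_mono p S"
    using z_opt_le[OF assms(3) x] by simp
  also have "\<dots> = (\<Sum>\<alpha>\<in>?M. ?c \<alpha> * (monom_eval \<alpha> x - w \<alpha>))"
    by (simp add: mvpoly_eval_def z sum_subtractf right_diff_distrib)
  also have "\<dots> \<le> real (card ?M) * L' p"
    using term_le by (rule sum_bounded_above)
  \<comment> \<open>Fewer monomials may appear than there are exponents of degree at most
    \<open>m\<close>; enlarging the count uses \<open>0 \<le> L' p\<close>.\<close>
  also have "\<dots> \<le> real ((CARD('n) + m) choose CARD('n)) * L' p"
    using card L'_nonneg by (intro mult_right_mono) auto
  finally show ?thesis by (simp add: mult.commute)
qed

end
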